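(* Let $q$ be an odd prime power and let $d$ be an odd positive integer. Assume that $q \equiv -1 \pmod d$, $q \equiv 1 \pmod 4$ and $\gcd\left(\frac{q+1}{d},d\right)=1$. Let $c \in \mathbb{F}_{q^2}$ be such that $\left(\frac{c}{2}\right)^{\frac{q+1}{2}} = 1$, let $r$ be a positive integer and let $k$ be an odd integer. Let $u=\frac{q+1}{d}+1$ and $u_1=(d-1)\frac{q+1}{d}+1$, and suppose that the exponents $u_1+k$ and $qu+2+k$ are nonnegative. Let $$h(x)=c+x^{u_1+k}+x^{qu+2+k}\in\mathbb{F}_{q^2}[x].$$ Let $s$ be a positive integer with $s \equiv \frac{q+1}{d} \pmod d$ and $s\le d$. Then $f(x)=x^r h(x^{q-1})$ is a permutation polynomial of $\mathbb{F}_{q^2}$ if and only if $\gcd\left(r-k-1,\frac{q+1}{d}\right)=1$, $\gcd(r,q-1)=1$ and $\gcd(s+r-k-1,d)=1$.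
   Context: $\mathbb{F}_{q^2}$ denotes the finite field with $q^2$ elements. A polynomial $f\in\mathbb{F}_{q^2}[x]$ is a permutation polynomial of $\mathbb{F}_{q^2}$ if the map $a\mapsto f(a)$ from $\mathbb{F}_{q^2}$ to itself is a bijection. *)

theory Defs
  imports "HOL-Computational_Algebra.Computational_Algebra" "HOL-Number_Theory.Prime_Powers" "HOL-Number_Theory.Cong"
begin

definition permutation_polynomial :: "'a::finite_field poly \<Rightarrow> bool" where
  "permutation_polynomial f \<longleftrightarrow> bij (poly f)"

end

(* On the (q+1)-th roots of unity both nonconstant monomials of h agree with X^e for the even
   exponent e = 1 + k - (q+1)/d, so h(X) = 2 (b + X^e) with b = c/2. Both b and X^e are
   ((q+1)/2)-th roots of unity and (q+1)/2 is odd, so b + X^e is nonzero; as raising to the q-th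
   power is additive and inverts roots of unity, h(X)^(q-1) = b^(-1) X^(-e). Hence f induces the
   monomial map X -> b^(-1) X^(r-e) on (q-1)-th powers, and f permutes the field iff r is coprime
   to q-1 and r-e is coprime to q+1. *)
theory Submission
  imports Defs "HOL-Number_Theory.Residues"
begin

section \<open>Roots of unity and Frobenius in a finite field\<close>

lemma card_power_eq_1_le:
  fixes n :: nat
  assumes "n > 0"
  shows "card {x :: 'a :: idom. x ^ n = 1} \<le> n"
proof -
  let ?p = "Polynomial.monom 1 n + [:- 1:] :: 'a poly"
  have deg: "degree ?p = n"
    using assms by (simp add: degree_add_eq_left degree_monom_eq)
  have "?p \<noteq> 0"
    using deg assms by auto
  then have "card {x. poly ?p x = 0} \<le> degree ?p"
    by (intro card_poly_roots_bound)
  then show ?thesis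
    by (simp add: deg poly_monom eq_neg_iff_add_eq_0)
qed

lemma finite_field_power_card_minus_1:
  fixes x :: "'a :: finite_field"
  assumes "x \<noteq> 0"
  shows "x ^ (card (UNIV :: 'a set) - 1) = 1"
proof -
  have "card (UNIV :: 'a set) > 0"
    by (simp add: card_gt_0_iff)
  then have "x ^ (card (UNIV :: 'a set) - 1) * x = x ^ card (UNIV :: 'a set)"
    by (rule power_minus_mult)
  with assms show ?thesis
    by (simp add: finite_field_power_card_eq_same)
qed

text \<open>A root count stands in for cyclicity of the multiplicative group. Let \<open>N\<close>
  be the number of nonzero elements and \<open>N = n * j\<close>. Every \<open>x ^ j\<close> with
  \<open>x\<close> nonzero is an \<open>n\<close>-th root of unity; if all of these had
  \<open>m\<close>-th power 1, then \<open>X ^ (j * m) - 1\<close> would have \<open>N\<close>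
  roots, although \<open>j * m < N\<close>.\<close>

lemma exists_root_of_unity_not_lower:
  fixes m n :: nat
  assumes dvd: "n dvd card (UNIV :: 'a :: finite_field set) - 1" and "0 < m" "m < n"
  shows "\<exists>y :: 'a. y ^ n = 1 \<and> y ^ m \<noteq> 1"
proof (rule ccontr)
  assume contra: "\<not> ?thesis"
  let ?N = "card (UNIV :: 'a set) - 1"
  obtain j where j: "?N = n * j"
    using dvd by blast
  have "card {0, 1 :: 'a} \<le> card (UNIV :: 'a set)"
    by (intro card_mono) auto
  then have N: "?N > 0"
    by simp
  with j have "j > 0"
    by (cases j) auto
  have "x ^ (j * m) = 1" if "x \<noteq> 0" for x :: 'a
  proof -
    have "(x ^ j) ^ n = 1"
      using finite_field_power_card_minus_1[OF that] unfolding j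
      by (simp add: mult.commute flip: power_mult)
    with contra show ?thesis
      by (auto simp: power_mult)
  qed
  then have "UNIV - {0} \<subseteq> {x :: 'a. x ^ (j * m) = 1}"
    by auto
  then have "card (UNIV - {0 :: 'a}) \<le> card {x :: 'a. x ^ (j * m) = 1}"
    by (intro card_mono) auto
  also have "\<dots> \<le> j * m"
    using \<open>j > 0\<close> \<open>0 < m\<close> by (intro card_power_eq_1_le) simp
  also have "\<dots> < ?N"
    using \<open>j > 0\<close> \<open>m < n\<close> unfolding j by simp
  finally show False
    by (simp add: card_Diff_subset)
qed

text \<open>The characteristic is a prime dividing \<open>q ^ n\<close>, hence the prime of which
  \<open>q\<close> is a power, so the map to \<open>q\<close>-th powers is an iterate of
  Frobenius.\<close>

lemma frobenius_add:
  fixes x y :: "'a :: finite_field"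
  assumes "primepow q" and card: "card (UNIV :: 'a set) = q ^ n"
  shows "(x + y) ^ q = x ^ q + y ^ q"
proof -
  obtain p i where p: "prime p" "q = p ^ i"
    using \<open>primepow q\<close> by (auto simp: primepow_def)
  have "CHAR('a) dvd p ^ (i * n)"
    using CHAR_dvd_CARD[where 'a = 'a] by (simp add: card p power_mult)
  then have "CHAR('a) = p"
    using p(1) CHAR_prime[where 'a = 'a] by (metis prime_dvd_power primes_dvd_imp_eq)
  then show ?thesis
    using freshmans_dream'[of q i x y] p by simp
qed

section \<open>Integer exponents on roots of unity\<close>

text \<open>The exponents differ by a multiple of \<open>n\<close>, and \<open>x ^ n = 1\<close>.
  For \<open>n = 0\<close> the element \<open>x\<close> may be 0, but then the congruence is an
  equality.\<close>

lemma power_int_cong_root_of_unity: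
  fixes x :: "'a :: field"
  assumes x: "x ^ n = 1" and cong: "[a = b] (mod int n)"
  shows "x powi a = x powi b"
proof (cases "n = 0")
  case False
  then have [simp]: "x \<noteq> 0"
    using x by (metis power_0_left zero_neq_one)
  obtain t where "a = b + int n * t"
    using cong_sym[OF cong] unfolding cong_iff_lin by blast
  then have "x powi a = x powi b * (x powi int n) powi t"
    by (simp add: power_int_add power_int_mult)
  then show ?thesis
    by (simp add: x)
qed (use cong in simp)

lemma coprime_power_int_eq_1:
  fixes x :: "'a :: field"
  assumes "x \<noteq> 0" and n: "x powi n = 1" and m: "x powi m = 1" and "coprime n m"
  shows "x = 1"
proof -
  obtain s t where "s * n + t * m = 1"
    using bezout_int[of n m] \<open>coprime n m\<close> by auto
  then have "x = x powi (n * s + m * t)"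
    by (simp add: mult.commute)
  also have "\<dots> = 1"
    using \<open>x \<noteq> 0\<close> by (simp add: power_int_add power_int_mult n m)
  finally show ?thesis .
qed

text \<open>If \<open>s\<close> inverts \<open>r\<close> modulo \<open>n\<close>, then
  \<open>t powi s\<close> is the required root.\<close>

lemma exists_power_eq_of_coprime:
  fixes t :: "'a :: field"
  assumes t: "t ^ n = 1" and "coprime r n"
  shows "\<exists>a. a ^ n = 1 \<and> a ^ r = t"
proof -
  obtain s where s: "[int r * s = 1] (mod int n)"
    using cong_solve_coprime_int[of "int r" "int n"] \<open>coprime r n\<close> by auto
  have "(t powi s) ^ n = (t ^ n) powi s"
    by (simp add: power_int_power power_int_power' mult.commute)
  moreover have "(t powi s) ^ r = t powi (int r * s)"
    by (simp add: power_int_power' mult.commute)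
  moreover have "t powi (int r * s) = t"
    using power_int_cong_root_of_unity[OF t s] by simp
  ultimately show ?thesis
    using t by (metis power_int_1_left)
qed

section \<open>Permutation criterion through the induced map on (q-1)-th powers\<close>

text \<open>The integer \<open>n\<close> is the exponent of the map induced by \<open>f\<close> on \<open>(q - 1)\<close>-th powers.\<close>

lemma bij_power_mult_iff:
  fixes f h :: "'a :: finite_field \<Rightarrow> 'a" and n :: int
  assumes card: "card (UNIV :: 'a set) = q ^ 2" and "q > 1" and "r > 0" and "\<beta> \<noteq> 0"
    and f: "\<And>x. f x = x ^ r * h (x ^ (q - 1))"
    and h: "\<And>X. X ^ (q + 1) = 1 \<Longrightarrow> X ^ r * h X ^ (q - 1) = \<beta> * X powi n"
  shows "bij f \<longleftrightarrow> coprime r (q - 1) \<and> coprime n (int (q + 1))"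
proof -
  have card': "card (UNIV :: 'a set) - 1 = (q - 1) * (q + 1)"
    using \<open>q > 1\<close> by (simp add: card power2_eq_square algebra_simps)
  have unit: "(x ^ (q - 1)) ^ (q + 1) = 1" if "x \<noteq> 0" for x :: 'a
    using finite_field_power_card_minus_1[OF that] by (simp only: card' power_mult)
  have f_pow: "f x ^ (q - 1) = \<beta> * (x ^ (q - 1)) powi n" if "x \<noteq> 0" for x
    using h[OF unit[OF that]] by (simp add: f power_mult_distrib mult.commute flip: power_mult)
  have f0: "f 0 = 0"
    using \<open>r > 0\<close> by (simp add: f)
  have f_nz: "f x \<noteq> 0" if "x \<noteq> 0" for x
    using f_pow[OF that] that \<open>\<beta> \<noteq> 0\<close> \<open>q > 1\<close>
    by (metis mult_eq_0_iff power_eq_0_iff power_int_eq_0_iff zero_less_diff zero_power)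
  \<comment> \<open>Scaling by such an \<open>a\<close> leaves the argument
    \<open>x ^ (q - 1)\<close> of \<open>h\<close> unchanged.\<close>
  have homogeneous: "f (a * x) = a ^ r * f x" if "a ^ (q - 1) = 1" for a x
    using that by (simp add: f power_mult_distrib)
  show ?thesis
  proof (intro iffI conjI)
    assume "bij f"
    then have inj: "f x = f y \<Longrightarrow> x = y" for x y
      by (metis bij_pointE)
    \<comment> \<open>Otherwise there is a \<zeta> different from 1 whose \<open>r\<close>-th and
      \<open>(q - 1)\<close>-th powers are both 1, and homogeneity gives \<open>f\<close> the same
      value at \<zeta> and at 1.\<close>
    show coprime_r: "coprime r (q - 1)"
    proof (rule ccontr)
      assume nc: "\<not> coprime r (q - 1)"
      define l where "l = gcd r (q - 1)"
      have "l > 1"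
        using nc \<open>r > 0\<close> unfolding l_def coprime_iff_gcd_eq_1
        by (metis gcd_pos_nat less_one nat_neq_iff)
      moreover have "l dvd card (UNIV :: 'a set) - 1"
        unfolding card' l_def by simp
      ultimately obtain \<zeta> :: 'a where \<zeta>: "\<zeta> ^ l = 1" "\<zeta> ^ 1 \<noteq> 1"
        using exists_root_of_unity_not_lower[of l 1] by auto
      have "\<zeta> ^ r = 1" "\<zeta> ^ (q - 1) = 1"
        using \<zeta>(1) unfolding l_def by (metis dvd_def gcd_dvd1 gcd_dvd2 power_mult power_one)+
      then have "f (\<zeta> * 1) = f 1"
        by (simp only: homogeneous) simp
      with inj \<zeta>(2) show False
        by fastforce
    qed
    \<comment> \<open>Otherwise choose \<open>y\<close> such that \<open>y ^ (q - 1)\<close> is a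
      nontrivial \<open>l\<close>-th root of unity, where \<open>l\<close> divides \<open>n\<close>.
      The induced map then fails to separate it from 1, so \<open>f y / f 1\<close> is a
      \<open>(q - 1)\<close>-th root of unity.\<close>
    show "coprime n (int (q + 1))"
    proof (rule ccontr)
      assume nc: "\<not> coprime n (int (q + 1))"
      define l where "l = nat (gcd n (int (q + 1)))"
      have l: "int l = gcd n (int (q + 1))"
        by (simp add: l_def)
      have "l \<noteq> 0"
        using l by (intro notI) (simp add: gcd_eq_0_iff)
      moreover have "l \<noteq> 1"
        using nc l by (auto simp: coprime_iff_gcd_eq_1)
      ultimately have "q - 1 < (q - 1) * l"
        using \<open>q > 1\<close> by simp
      moreover have "l dvd q + 1"
        using l by (metis gcd_dvd2 int_dvd_int_iff)
      then have "(q - 1) * l dvd card (UNIV :: 'a set) - 1"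
        unfolding card' by (intro mult_dvd_mono) auto
      ultimately obtain y :: 'a where y: "y ^ ((q - 1) * l) = 1" "y ^ (q - 1) \<noteq> 1"
        using exists_root_of_unity_not_lower[of "(q - 1) * l" "q - 1"] \<open>q > 1\<close> by auto
      have "y \<noteq> 0"
        using y(1) \<open>l \<noteq> 0\<close> \<open>q > 1\<close> by (auto simp: power_0_left)
      have "[n = 0] (mod int l)"
        using l by (simp add: cong_0_iff)
      then have "(y ^ (q - 1)) powi n = (y ^ (q - 1)) powi 0"
        using y(1) by (intro power_int_cong_root_of_unity[of _ l]) (simp_all add: power_mult)
      then have "f y ^ (q - 1) = f 1 ^ (q - 1)"
        using f_pow[OF \<open>y \<noteq> 0\<close>] f_pow[of 1] by simp
      then have "(f y / f 1) ^ (q - 1) = 1"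
        using f_nz[of 1] by (simp add: power_divide)
      \<comment> \<open>As \<open>r\<close> is coprime to \<open>q - 1\<close>, the ratio is an
        \<open>r\<close>-th power within the \<open>(q - 1)\<close>-th roots of unity. Scaling 1 by
        its root \<open>a\<close> yields a collision with \<open>y\<close>, since
        \<open>a ^ (q - 1) = 1\<close> while \<open>y ^ (q - 1)\<close> is not 1.\<close>
      then obtain a where a: "a ^ (q - 1) = 1" "a ^ r = f y / f 1"
        using exists_power_eq_of_coprime coprime_r by blast
      have "f (a * 1) = f y"
        using f_nz[of 1] by (simp only: homogeneous[OF a(1)] a(2)) simp
      then have "a * 1 = y"
        by (rule inj)
      with a(1) y(2) show False
        by simp
    qed
  next
    assume cop: "coprime r (q - 1) \<and> coprime n (int (q + 1))"
    have "x = y" if eq: "f x = f y" for x y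
    proof (cases "x = 0 \<or> y = 0")
      case True
      then show ?thesis
        using eq f0 f_nz by metis
    next
      case False
      then have [simp]: "x \<noteq> 0" "y \<noteq> 0"
        by auto
      \<comment> \<open>First the \<open>(q - 1)\<close>-th powers are shown to agree, by
        coprimality of \<open>n\<close> and \<open>q + 1\<close>. Then \<open>x / y\<close> scales
        \<open>f\<close> homogeneously, and coprimality of \<open>r\<close> and \<open>q - 1\<close>
        forces it to be 1.\<close>
      let ?X = "x ^ (q - 1)" and ?Y = "y ^ (q - 1)"
      have "?X powi n = ?Y powi n"
        using f_pow[of x] f_pow[of y] eq \<open>\<beta> \<noteq> 0\<close> by simp
      then have "(?X / ?Y) powi n = 1"
        by (simp add: power_int_divide_distrib)
      moreover have "(?X / ?Y) powi int (q + 1) = 1"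
        by (simp only: power_int_of_nat power_divide unit \<open>x \<noteq> 0\<close> \<open>y \<noteq> 0\<close> div_by_1 not_False_eq_True)
      moreover have "?X / ?Y \<noteq> 0"
        by simp
      ultimately have "?X / ?Y = 1"
        using cop coprime_power_int_eq_1 by blast
      then have XY: "?X = ?Y"
        by simp
      have "(x / y) ^ (q - 1) = 1"
        using XY by (simp add: power_divide)
      moreover have "f x = (x / y) ^ r * f y"
        using homogeneous[OF calculation, of y] by simp
      then have "(x / y) ^ r = 1"
        using eq f_nz[of y] by simp
      ultimately have "x / y = 1"
        using cop coprime_power_int_eq_1[of "x / y" "int r" "int (q - 1)"]
        unfolding power_int_of_nat coprime_int_iff by simp
      then show ?thesis
        by simp
    qed
    then have "inj f"
      by (rule injI)
    then show "bij f"
      by (simp add: bij_def finite_UNIV_inj_surj)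
  qed
qed

section \<open>Values of h on the (q+1)-th roots of unity\<close>

text \<open>Here \<open>x ^ q\<close> is the inverse of \<open>x\<close> and likewise for
  \<open>y\<close>, so \<open>(x + y) ^ q\<close> equals \<open>(x + y) / (x * y)\<close>; cancel
  one factor \<open>x + y\<close>.\<close>

lemma add_power_q_minus_1:
  fixes x y :: "'a :: field"
  assumes add: "(x + y) ^ q = x ^ q + y ^ q" and "q > 0" and "x + y \<noteq> 0"
    and x: "x ^ (q + 1) = 1" and y: "y ^ (q + 1) = 1"
  shows "(x + y) ^ (q - 1) = inverse (x * y)"
proof -
  have "x * y * (x + y) ^ q = x ^ (q + 1) * y + y ^ (q + 1) * x"
    unfolding add by (simp add: algebra_simps)
  also have "\<dots> = x + y"
    by (simp only: x y) simp
  finally have "(x + y) * (x * y * (x + y) ^ (q - 1)) = (x + y) * 1"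
    using power_minus_mult[OF \<open>q > 0\<close>, of "x + y"] by (simp add: mult_ac)
  then have "x * y * (x + y) ^ (q - 1) = 1"
    using \<open>x + y \<noteq> 0\<close> by (metis mult_left_cancel)
  then show ?thesis
    by (metis inverse_unique)
qed

theorem theorem1p2:
  fixes q d r s u u\<^sub>1 :: nat and k :: int and c :: "'a::finite_field" and h f :: "'a poly"
  assumes "primepow q" and "odd q"
    and field_card: "card (UNIV :: 'a set) = q ^ 2"
    and "d > 0" and "odd d"
    and "[int q = - 1] (mod int d)" and "[q = 1] (mod 4)"
    and "gcd ((q + 1) div d) d = 1"
    and "(c / 2) ^ ((q + 1) div 2) = 1"
    and "r > 0" and "odd k"
    and u_def: "u = (q + 1) div d + 1"
    and u1_def: "u\<^sub>1 = (d - 1) * ((q + 1) div d) + 1"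
    and "int u\<^sub>1 + k \<ge> 0" and "int (q * u + 2) + k \<ge> 0"
    and h_def: "h = [:c:] + Polynomial.monom 1 (nat (int u\<^sub>1 + k)) + Polynomial.monom 1 (nat (int (q * u + 2) + k))"
    and "s > 0" and "[s = (q + 1) div d] (mod d)" and "s \<le> d"
    and f_def: "f = Polynomial.monom 1 r * pcompose h (Polynomial.monom 1 (q - 1))"
  shows "permutation_polynomial f \<longleftrightarrow>
    gcd (int r - k - 1) (int ((q + 1) div d)) = 1 \<and>
    gcd r (q - 1) = 1 \<and>
    gcd (int s + int r - k - 1) (int d) = 1"
proof -
  define m where "m = (q + 1) div d"
  define e where "e = 1 + k - int m"
  define b where "b = c / 2"
  have "q > 1"
    using \<open>primepow q\<close> primepow_gt_Suc_0 by auto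
  have "int d dvd int q + 1"
    using \<open>[int q = - 1] (mod int d)\<close> by (simp add: cong_iff_dvd_diff)
  then have "int d dvd int (q + 1)"
    by (simp add: add.commute)
  then have "d dvd q + 1"
    by (simp only: int_dvd_int_iff)
  then have q1: "q + 1 = d * m"
    by (simp add: m_def)
  have "q mod 4 = 1"
    using \<open>[q = 1] (mod 4)\<close> by (simp add: cong_def)
  then have half: "odd ((q + 1) div 2)" "q + 1 = 2 * ((q + 1) div 2)"
    by presburger+
  have "even m"
    using q1 half(2) \<open>odd d\<close> by (metis dvd_triv_left even_mult_iff)
  then have "even e"
    using \<open>odd k\<close> by (simp add: e_def)
  have b_half: "b ^ ((q + 1) div 2) = 1"
    using assms(9) by (simp add: b_def)
  then have "b \<noteq> 0"
    using half(1) by (metis odd_pos zero_neq_one zero_power)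
  \<comment> \<open>if 2 = 0 then c / 2 = 0 by the convention for division\<close>
  then have two: "(2 :: 'a) \<noteq> 0"
    by (auto simp: b_def)
  then have c: "c = 2 * b"
    by (simp add: b_def)
  have b_unit: "b ^ (q + 1) = 1"
    by (subst half(2), subst mult.commute) (simp only: power_mult b_half power_one)
  note add = frobenius_add[OF \<open>primepow q\<close> field_card]
  \<comment> \<open>The factor 2 in \<open>h\<close> must vanish under the \<open>(q - 1)\<close>-th
    power; additivity of Frobenius at 1 + 1 shows this.\<close>
  have "(2 :: 'a) ^ q = 2"
    using add[of 1 1] by simp
  then have two_pow: "(2 :: 'a) ^ (q - 1) = 1"
    using two \<open>q > 1\<close> power_minus_mult[of q "2 :: 'a"] by simp
  have h_eq: "poly h X = 2 * (b + X powi e)" if X: "X ^ (q + 1) = 1" for X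
  proof -
    have u1: "int u\<^sub>1 = int (q + 1) - int m + 1"
      using \<open>d > 0\<close> unfolding u1_def q1 m_def[symmetric]
      by (simp add: of_nat_diff algebra_simps)
    have "X ^ nat (int u\<^sub>1 + k) = X powi (int u\<^sub>1 + k)"
      using \<open>int u\<^sub>1 + k \<ge> 0\<close> by (simp add: power_int_nonneg_exp)
    also have "\<dots> = X powi e"
    proof (rule power_int_cong_root_of_unity[OF X])
      have "int u\<^sub>1 + k - e = int (q + 1) * 1"
        by (simp add: u1 e_def)
      then show "[int u\<^sub>1 + k = e] (mod int (q + 1))"
        unfolding cong_iff_dvd_diff by (metis dvd_triv_left)
    qed
    finally have 1: "X ^ nat (int u\<^sub>1 + k) = X powi e" .
    have "X ^ nat (int (q * u + 2) + k) = X powi (int (q * u + 2) + k)"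
      using \<open>int (q * u + 2) + k \<ge> 0\<close> by (simp add: power_int_nonneg_exp)
    also have "\<dots> = X powi e"
    proof (rule power_int_cong_root_of_unity[OF X])
      have u: "u = m + 1"
        by (simp only: u_def m_def)
      have "int (q * u + 2) + k - e = int (q + 1) * (int m + 1)"
        by (simp add: u e_def algebra_simps)
      then show "[int (q * u + 2) + k = e] (mod int (q + 1))"
        unfolding cong_iff_dvd_diff by (metis dvd_triv_left)
    qed
    finally show ?thesis
      by (simp only: h_def 1 poly_add poly_monom poly_pCons c) (simp add: algebra_simps)
  qed
  have h_pow: "X ^ r * poly h X ^ (q - 1) = inverse b * X powi (int r - e)"
    if X: "X ^ (q + 1) = 1" for X
  proof -
    have [simp]: "X \<noteq> 0"
      using X by auto
    define Y where "Y = X powi e"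
    obtain j where j: "e = 2 * j"
      using \<open>even e\<close> by blast
    \<comment> \<open>Evenness of \<open>e\<close> turns half of \<open>q + 1\<close> into a full
      multiple: \<open>e * ((q + 1) div 2)\<close> is \<open>(q + 1) * j\<close>.\<close>
    have "Y ^ ((q + 1) div 2) = X powi (e * int ((q + 1) div 2))"
      by (simp only: Y_def power_int_power')
    also have "e * int ((q + 1) div 2) = int (2 * ((q + 1) div 2)) * j"
      by (simp only: j of_nat_mult of_nat_numeral mult_ac)
    also have "\<dots> = int (q + 1) * j"
      by (simp only: half(2)[symmetric])
    also have "X powi \<dots> = 1"
      by (simp only: power_int_mult power_int_of_nat X power_int_1_left)
    finally have Y_half: "Y ^ ((q + 1) div 2) = 1" .
    then have Y_unit: "Y ^ (q + 1) = 1"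
      by (subst half(2), subst mult.commute) (simp only: power_mult power_one)
    \<comment> \<open>If \<open>Y = - b\<close>, raising to the odd exponent
      \<open>(q + 1) div 2\<close> gives 1 = -1, which contradicts that 2 is nonzero.\<close>
    have "b + Y \<noteq> 0"
    proof
      assume "b + Y = 0"
      then have "Y = - b"
        by (simp add: eq_neg_iff_add_eq_0 add.commute)
      then have "(1 :: 'a) = - 1"
        using Y_half b_half half(1) by (simp add: power_minus_odd)
      with two show False
        by (metis add.right_inverse one_add_one)
    qed
    then have "(b + Y) ^ (q - 1) = inverse (b * Y)"
      using \<open>q > 1\<close> by (intro add_power_q_minus_1 add b_unit Y_unit) auto
    then have "poly h X ^ (q - 1) = inverse (b * Y)"
      by (simp only: h_eq[OF X] Y_def[symmetric] power_mult_distrib two_pow mult_1_left)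
    moreover have "X powi (int r - e) = X ^ r / Y"
      by (simp add: power_int_diff Y_def)
    ultimately show ?thesis
      by (simp add: field_simps)
  qed
  have f: "poly f x = x ^ r * poly h (x ^ (q - 1))" for x
    by (simp add: f_def poly_monom poly_pcompose)
  have "permutation_polynomial f \<longleftrightarrow> coprime r (q - 1) \<and> coprime (int r - e) (int (q + 1))"
    unfolding permutation_polynomial_def
    using \<open>q > 1\<close> \<open>r > 0\<close> \<open>b \<noteq> 0\<close> f h_pow
    by (intro bij_power_mult_iff[OF field_card, of r "inverse b" _ "poly h"]) auto
  \<comment> \<open>The condition modulo \<open>q + 1 = d * m\<close> splits over the two factors.
    Since \<open>r - e = r - k - 1 + m\<close>, the term \<open>m\<close> drops out modulo
    \<open>m\<close> and may be replaced by \<open>s\<close> modulo \<open>d\<close>.\<close>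
  moreover have "coprime (int r - e) (int (q + 1)) \<longleftrightarrow>
      coprime (int r - e) (int d) \<and> coprime (int r - e) (int m)"
    unfolding q1 by (simp add: coprime_mult_right_iff)
  moreover have "coprime (int r - e) (int m) \<longleftrightarrow> coprime (int r - k - 1) (int m)"
    by (rule coprime_cong_cong_left) (simp add: cong_iff_dvd_diff e_def)
  moreover have "coprime (int r - e) (int d) \<longleftrightarrow> coprime (int s + int r - k - 1) (int d)"
  proof (rule coprime_cong_cong_left)
    have "[int s = int m] (mod int d)"
      using \<open>[s = (q + 1) div d] (mod d)\<close> by (simp add: m_def cong_int_iff)
    then have "int d dvd int m - int s"
      using cong_sym by (simp add: cong_iff_dvd_diff dvd_diff_commute)
    moreover have "int m - int s = int r - e - (int s + int r - k - 1)"
      by (simp add: e_def)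
    ultimately show "[int r - e = int s + int r - k - 1] (mod int d)"
      by (simp add: cong_iff_dvd_diff)
  qed
  ultimately show ?thesis
    unfolding m_def[symmetric] coprime_iff_gcd_eq_1 by auto
qed

end
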